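(* (1) Every subset of $\mathbb{N}^{\mathbb{N}}$ satisfies the semi excluded middle property with respect to $\langle<,\le\rangle$; thus $\mathfrak{x}''_{<,\le}=\mathfrak{x}''_{<,<}=\infty$. (2) $\mathfrak{x}'_{\le,\le}=\mathfrak{x}'_{\le,<}=\mathfrak{x}''_{\le,\le}=\mathfrak{x}''_{\le,<}=\mathfrak{b}$. (3) $\mathfrak{x}'_{<,\le}=\mathfrak{x}'_{<,<}=\max\{\mathfrak{s},\mathfrak{b}\}$.
   Context: $f\le^*g$ means $f(n)\le g(n)$ for all but finitely many $n$; $\mathfrak{b}$ is the minimal size of a $\le^*$-unbounded subset of $\mathbb{N}^{\mathbb{N}}$. $\mathfrak{s}$ is the minimal size of a family $\mathcal{S}$ of infinite subsets of $\mathbb{N}$ such that every infinite $A\subseteq\mathbb{N}$ has $A\cap S$ and $A\setminus S$ infinite for some $S\in\mathcal{S}$. For $R,S\in\{\le,<\}$, $X\subseteq\mathbb{N}^{\mathbb{N}}$ and $g\in\mathbb{N}^{\mathbb{N}}$: $g$ semi avoids middles in $X$ w.r.t. $\langle R,S\rangle$ if for all $f,h\in X$ at least one of $\{n: f(n)Rg(n)\text{ and }g(n)Sh(n)\}$, $\{n: h(n)Rg(n)\text{ and }g(n)Sf(n)\}$ is finite; $g$ quasi avoids middles in $X$ if additionally $g$ is unbounded (its range is infinite). $X$ satisfies the quasi (resp. semi) excluded middle property w.r.t. $\langle R,S\rangle$ if some $g$ quasi (resp. semi) avoids middles in $X$. $\mathfrak{x}'_{R,S}$ (resp. $\mathfrak{x}''_{R,S}$)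 is the minimal size of a subset of $\mathbb{N}^{\mathbb{N}}$ failing the quasi (resp. semi) excluded middle property w.r.t. $\langle R,S\rangle$, and is $\infty$ if no such subset exists. *)

theory Defs
  imports Main
begin

unbundle cardinal_syntax

text \<open>
  Cardinals are represented as in the library, by cardinal well-orders compared with \<open>=o\<close>
  and \<open>\<le>o\<close>, which also compare cardinals living on different types. In an extended
  cardinal, of type \<open>'a rel option\<close>, the value \<^term>\<open>None\<close> stands for infinity.
\<close>

text \<open>Meaningful for nonempty \<open>K\<close> only; see \<open>least_card_attained\<close> below.\<close>

definition least_card :: "'a set set \<Rightarrow> 'a rel" where
  "least_card K = |SOME X. X \<in> K \<and> (\<forall>Y\<in>K. |X| \<le>o |Y| )|"

definition least_ecard :: "'a set set \<Rightarrow> 'a rel option" where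
  "least_ecard K = (if K = {} then None else Some (least_card K))"

abbreviation ecard_eq :: "'a rel option \<Rightarrow> 'b rel option \<Rightarrow> bool" (infix \<open>=e\<close> 50) where
  "r =e s \<equiv> rel_option ordIso2 r s"

text \<open>The sum type is only needed because the two arguments may live on different types.\<close>

definition cmax :: "'a rel \<Rightarrow> 'b rel \<Rightarrow> ('a + 'b) rel" where
  "cmax r s = (if r \<le>o s then |Inr ` Field s| else |Inl ` Field r| )"

lemma least_card_attained:
  assumes "K \<noteq> {}"
  shows "\<exists>X\<in>K. least_card K = |X| \<and> (\<forall>Y\<in>K. |X| \<le>o |Y| )"
proof -
  have "\<exists>r\<in>card_of ` K. \<forall>r'\<in>card_of ` K. r \<le>o r'"
    by (rule exists_minim_Card_order) (use assms card_of_Card_order in auto)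
  then have "\<exists>X. X \<in> K \<and> (\<forall>Y\<in>K. |X| \<le>o |Y| )" by auto
  from someI_ex[OF this] show ?thesis unfolding least_card_def by blast
qed

lemma cmax_ordIso:
  assumes "Card_order r" "Card_order s"
  shows "cmax r s =o r \<and> s \<le>o r \<or> cmax r s =o s \<and> r \<le>o s"
proof -
  have "|Field s| =o |Inr ` Field s :: ('a + 'b) set|" "|Field r| =o |Inl ` Field r :: ('a + 'b) set|"
    by (rule card_of_ordIsoI, rule inj_on_imp_bij_betw, simp)+
  then have "|Inr ` Field s :: ('a + 'b) set| =o s" "|Inl ` Field r :: ('a + 'b) set| =o r"
    using assms card_of_Field_ordIso ordIso_transitive ordIso_symmetric by blast+
  moreover have "r \<le>o s \<or> s \<le>o r"
    using assms ordLeq_total by (auto simp: card_order_on_def)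
  ultimately show ?thesis unfolding cmax_def by auto
qed


definition le_star :: "(nat \<Rightarrow> nat) \<Rightarrow> (nat \<Rightarrow> nat) \<Rightarrow> bool" (infix \<open>\<le>*\<close> 50) where
  "f \<le>* g \<longleftrightarrow> (\<forall>\<^sub>\<infinity>n. f n \<le> g n)"

definition le_star_bounded :: "(nat \<Rightarrow> nat) set \<Rightarrow> bool" where
  "le_star_bounded X \<longleftrightarrow> (\<exists>g. \<forall>f\<in>X. f \<le>* g)"

definition bounding_number :: "(nat \<Rightarrow> nat) rel" where
  "bounding_number = least_card {X. \<not> le_star_bounded X}"

definition splitting_family :: "nat set set \<Rightarrow> bool" where
  "splitting_family \<S> \<longleftrightarrow>
     (\<forall>S\<in>\<S>. infinite S) \<and>
     (\<forall>A. infinite A \<longrightarrow> (\<exists>S\<in>\<S>. infinite (A \<inter> S) \<and> infinite (A - S)))"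

definition splitting_number :: "nat set rel" where
  "splitting_number = least_card {\<S>. splitting_family \<S>}"


type_synonym nat_rel = "nat \<Rightarrow> nat \<Rightarrow> bool"

definition semi_avoids_middles :: "nat_rel \<Rightarrow> nat_rel \<Rightarrow> (nat \<Rightarrow> nat) \<Rightarrow> (nat \<Rightarrow> nat) set \<Rightarrow> bool" where
  "semi_avoids_middles R S g X \<longleftrightarrow>
     (\<forall>f\<in>X. \<forall>h\<in>X. finite {n. R (f n) (g n) \<and> S (g n) (h n)} \<or>
                  finite {n. R (h n) (g n) \<and> S (g n) (f n)})"

definition quasi_avoids_middles :: "nat_rel \<Rightarrow> nat_rel \<Rightarrow> (nat \<Rightarrow> nat) \<Rightarrow> (nat \<Rightarrow> nat) set \<Rightarrow> bool" where
  "quasi_avoids_middles R S g X \<longleftrightarrow> semi_avoids_middles R S g X \<and> infinite (range g)"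

definition semi_excluded_middle :: "nat_rel \<Rightarrow> nat_rel \<Rightarrow> (nat \<Rightarrow> nat) set \<Rightarrow> bool" where
  "semi_excluded_middle R S X \<longleftrightarrow> (\<exists>g. semi_avoids_middles R S g X)"

definition quasi_excluded_middle :: "nat_rel \<Rightarrow> nat_rel \<Rightarrow> (nat \<Rightarrow> nat) set \<Rightarrow> bool" where
  "quasi_excluded_middle R S X \<longleftrightarrow> (\<exists>g. quasi_avoids_middles R S g X)"

definition x_quasi :: "nat_rel \<Rightarrow> nat_rel \<Rightarrow> (nat \<Rightarrow> nat) rel option" where
  "x_quasi R S = least_ecard {X. \<not> quasi_excluded_middle R S X}"

definition x_semi :: "nat_rel \<Rightarrow> nat_rel \<Rightarrow> (nat \<Rightarrow> nat) rel option" where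
  "x_semi R S = least_ecard {X. \<not> semi_excluded_middle R S X}"


text \<open>The bounding and splitting numbers are least cardinals of nonempty classes.\<close>

lemma not_le_star_bounded_UNIV: "\<not> le_star_bounded UNIV"
proof
  assume "le_star_bounded UNIV"
  then obtain g where "(\<lambda>n. Suc (g n)) \<le>* g" unfolding le_star_bounded_def by blast
  then show False by (simp add: le_star_def eventually_cofinite)
qed

lemma splitting_family_infinite_sets: "splitting_family {S. infinite S}"
proof -
  have "\<exists>S. infinite S \<and> infinite (A \<inter> S) \<and> infinite (A - S)" if A: "infinite A" for A :: "nat set"
  proof -
    obtain e :: "nat \<Rightarrow> nat" where e: "inj e" "range e \<subseteq> A"
      using A infinite_countable_subset by blast
    have ev: "infinite {n :: nat. even n}"
    proof
      assume "finite {n :: nat. even n}"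
      then have "finite (range (\<lambda>n::nat. 2 * n))" by (rule rev_finite_subset) auto
      then show False by (auto dest: finite_imageD simp: inj_on_def)
    qed
    have od: "infinite {n :: nat. odd n}"
    proof
      assume "finite {n :: nat. odd n}"
      then have "finite (range (\<lambda>n::nat. 2 * n + 1))" by (rule rev_finite_subset) auto
      then show False by (auto dest: finite_imageD simp: inj_on_def)
    qed
    let ?S = "e ` {n. even n}"
    have S: "infinite ?S" and T: "infinite (e ` {n. odd n})"
      using ev od e(1) by (meson finite_imageD inj_on_subset subset_UNIV)+
    have "A \<inter> ?S = ?S" using e(2) by blast
    moreover have "e ` {n. odd n} \<subseteq> A - ?S" using e by (auto dest: injD)
    ultimately show ?thesis using S T finite_subset by metis
  qed
  then show ?thesis unfolding splitting_family_def by blast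
qed

end

theory Submission
  imports Defs "HOL-Library.Infinite_Set"
begin

text \<open>
  If \<open>X\<close> is bounded, any unbounded function eventually above every member of \<open>X\<close> has no middles
  at all. If \<open>A\<close> is split by none of the sets \<open>{n. f n < n}\<close> with \<open>f \<in> X\<close>, then the function equal to
  the identity on \<open>A\<close> and to \<open>0\<close> elsewhere lies, on almost all of \<open>A\<close>, on one fixed side of each
  \<open>f \<in> X\<close>, and no value is \<open>< 0\<close> outside \<open>A\<close>. Conversely, take \<open>b\<close> from an unbounded family, switch it
  off on a set \<open>S\<close> and on its complement: a function \<open>g\<close> is a middle of these two in both
  orders as soon as \<open>b\<close> exceeds \<open>g\<close> infinitely often both on \<open>S\<close> and off \<open>S\<close>. For \<open>\<langle>\<le>, <\<rangle>\<close> the set of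
  even numbers serves as \<open>S\<close>; for \<open>\<langle><, <\<rangle>\<close> the set \<open>S\<close> has to split the support of \<open>g\<close>, and \<open>b\<close> is
  replaced by its running maximum so that it exceeds \<open>g\<close> infinitely often on a prescribed infinite set.
\<close>

subsection \<open>Minimal cardinals\<close>

lemma Card_order_least_card: "Card_order (least_card K)"
  unfolding least_card_def by (rule card_of_Card_order)

lemma least_card_le:
  assumes "Y \<in> K"
  shows "least_card K \<le>o |Y|"
proof -
  have "K \<noteq> {}" using assms by blast
  from least_card_attained[OF this] show ?thesis using assms by auto
qed

text \<open>The two halves of each equality meet here: one small \<open>Y\<close> bounds the minimum
  from above, and the bound on all members of \<open>K\<close> bounds it from below.\<close>

lemma least_ecard_eqI:
  assumes "Y \<in> K" "|Y| \<le>o r" "\<And>Z. Z \<in> K \<Longrightarrow> r \<le>o |Z|"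
  shows "least_ecard K =e Some r"
proof -
  obtain Z where "Z \<in> K" "least_card K = |Z|"
    using least_card_attained[of K] assms(1) by auto
  then have "r \<le>o least_card K" using assms(3) by simp
  moreover have "least_card K \<le>o r"
    using least_card_le[OF assms(1)] assms(2) ordLeq_transitive by blast
  ultimately show ?thesis
    using assms(1) by (auto simp: least_ecard_def ordIso_iff_ordLeq)
qed

lemma bounding_number_le:
  assumes "\<not> le_star_bounded X"
  shows "bounding_number \<le>o |X|"
  unfolding bounding_number_def using assms by (intro least_card_le) simp

lemma splitting_number_le:
  assumes "splitting_family \<S>"
  shows "splitting_number \<le>o |\<S>|"
  unfolding splitting_number_def using assms by (intro least_card_le) simp

lemma bounding_number_attained:
  obtains B where "\<not> le_star_bounded B" "bounding_number = |B|"
proof -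
  have "{X. \<not> le_star_bounded X} \<noteq> {}" using not_le_star_bounded_UNIV by blast
  from least_card_attained[OF this] that show thesis
    unfolding bounding_number_def by blast
qed

lemma splitting_number_attained:
  obtains \<S> where "splitting_family \<S>" "splitting_number = |\<S>|"
proof -
  have "{\<S>. splitting_family \<S>} \<noteq> {}" using splitting_family_infinite_sets by blast
  from least_card_attained[OF this] that show thesis
    unfolding splitting_number_def by blast
qed

text \<open>The pointwise sum over \<open>X\<close> dominates every member. Used contrapositively:
  an unbounded family is infinite, so the rules for infinite cardinals apply to it.\<close>

lemma finite_imp_le_star_bounded:
  assumes "finite X"
  shows "le_star_bounded X"
proof -
  have "f \<le>* (\<lambda>n. \<Sum>h\<in>X. h n)" if "f \<in> X" for f
    unfolding le_star_def using member_le_sum[OF that _ assms, of "\<lambda>h. h _"] by simp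
  then show ?thesis unfolding le_star_bounded_def by blast
qed

text \<open>The failing families built below consist of two functions for each index.\<close>

lemma card_of_two_images_le:
  assumes "|A| \<le>o r" "infinite (Field r)" "Card_order r"
  shows "|F ` A \<union> H ` A| \<le>o r"
  using card_of_Un_ordLeq_infinite_Field[OF assms(2) _ _ assms(3)]
    ordLeq_transitive[OF card_of_image assms(1)] by blast

lemma not_le_star_iff: "\<not> f \<le>* g \<longleftrightarrow> infinite {n. g n < f n}"
  by (simp add: le_star_def eventually_cofinite not_le)

lemma le_cmax:
  assumes "Card_order r" "Card_order s"
  shows "r \<le>o cmax r s" "s \<le>o cmax r s"
  using cmax_ordIso[OF assms]
  by (metis ordIso_symmetric ordIso_imp_ordLeq ordLeq_ordIso_trans)+

lemma cmax_le:
  assumes "Card_order r" "Card_order s" "r \<le>o t" "s \<le>o t"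
  shows "cmax r s \<le>o t"
  using cmax_ordIso[OF assms(1,2)] assms(3,4) by (metis ordIso_ordLeq_trans)

subsection \<open>Comparison of the properties\<close>

text \<open>Stronger relations shrink both sets, so the same \<open>g\<close> still works; passing
  from \<open>\<le>\<close> to \<open><\<close> makes the property easier to satisfy.\<close>

lemma semi_avoids_middles_mono:
  assumes "semi_avoids_middles R S g X"
    and "\<And>m n. R' m n \<Longrightarrow> R m n" "\<And>m n. S' m n \<Longrightarrow> S m n"
  shows "semi_avoids_middles R' S' g X"
  unfolding semi_avoids_middles_def
proof (intro ballI)
  fix f h assume "f \<in> X" "h \<in> X"
  then consider "finite {n. R (f n) (g n) \<and> S (g n) (h n)}"
    | "finite {n. R (h n) (g n) \<and> S (g n) (f n)}"
    using assms(1) unfolding semi_avoids_middles_def by blast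
  then show "finite {n. R' (f n) (g n) \<and> S' (g n) (h n)} \<or>
             finite {n. R' (h n) (g n) \<and> S' (g n) (f n)}"
  proof cases
    case 1
    then have "finite {n. R' (f n) (g n) \<and> S' (g n) (h n)}"
      by (rule rev_finite_subset) (use assms(2,3) in blast)
    then show ?thesis ..
  next
    case 2
    then have "finite {n. R' (h n) (g n) \<and> S' (g n) (f n)}"
      by (rule rev_finite_subset) (use assms(2,3) in blast)
    then show ?thesis ..
  qed
qed

lemma quasi_excluded_middle_mono:
  assumes "quasi_excluded_middle R S X"
    and "\<And>m n. R' m n \<Longrightarrow> R m n" "\<And>m n. S' m n \<Longrightarrow> S m n"
  shows "quasi_excluded_middle R' S' X"
  using assms semi_avoids_middles_mono[of R S _ X R' S']
  unfolding quasi_excluded_middle_def quasi_avoids_middles_def by blast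

lemma semi_excluded_middle_mono:
  assumes "semi_excluded_middle R S X"
    and "\<And>m n. R' m n \<Longrightarrow> R m n" "\<And>m n. S' m n \<Longrightarrow> S m n"
  shows "semi_excluded_middle R' S' X"
  using assms semi_avoids_middles_mono[of R S _ X R' S']
  unfolding semi_excluded_middle_def by blast

lemma quasi_imp_semi_excluded_middle:
  "quasi_excluded_middle R S X \<Longrightarrow> semi_excluded_middle R S X"
  unfolding quasi_excluded_middle_def quasi_avoids_middles_def semi_excluded_middle_def by blast

lemma quasi_excluded_middleI:
  assumes "infinite (range g)"
    and "\<And>f h. f \<in> X \<Longrightarrow> h \<in> X \<Longrightarrow>
      finite {n. R (f n) (g n) \<and> S (g n) (h n)} \<or> finite {n. R (h n) (g n) \<and> S (g n) (f n)}"
  shows "quasi_excluded_middle R S X"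
  unfolding quasi_excluded_middle_def quasi_avoids_middles_def semi_avoids_middles_def
  using assms by (intro exI[of _ g]) simp

lemma not_semi_excluded_middleI:
  assumes "\<And>g. \<exists>f\<in>X. \<exists>h\<in>X. infinite {n. R (f n) (g n) \<and> S (g n) (h n)} \<and>
                          infinite {n. R (h n) (g n) \<and> S (g n) (f n)}"
  shows "\<not> semi_excluded_middle R S X"
  using assms unfolding semi_excluded_middle_def semi_avoids_middles_def by simp

lemma not_quasi_excluded_middleI:
  assumes "\<And>g. infinite (range g) \<Longrightarrow>
      \<exists>f\<in>X. \<exists>h\<in>X. infinite {n. R (f n) (g n) \<and> S (g n) (h n)} \<and>
                  infinite {n. R (h n) (g n) \<and> S (g n) (f n)}"
  shows "\<not> quasi_excluded_middle R S X"
  using assms unfolding quasi_excluded_middle_def quasi_avoids_middles_def semi_avoids_middles_def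
  by auto

lemma semi_excluded_middle_less_le: "semi_excluded_middle (<) (\<le>) X"
  unfolding semi_excluded_middle_def semi_avoids_middles_def
  \<comment> \<open>Nothing is strictly below 0, so both sets are empty.\<close>
  by (rule exI[of _ "\<lambda>_. 0"]) simp

subsection \<open>Lower bounds\<close>

lemma le_star_bounded_imp_quasi_excluded_middle:
  assumes "le_star_bounded X"
  shows "quasi_excluded_middle (\<le>) (\<le>) X"
proof -
  obtain g where g: "\<And>f. f \<in> X \<Longrightarrow> f \<le>* g"
    using assms unfolding le_star_bounded_def by blast
  \<comment> \<open>\<open>Suc\<close> turns \<open>?g n \<le> h n\<close> into
    \<open>g n < h n\<close>, which happens only finitely often; the summand \<open>n\<close> makes
    the range infinite.\<close>
  let ?g = "\<lambda>n. Suc (g n + n)"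
  have "finite {n. f n \<le> ?g n \<and> ?g n \<le> h n}" if "h \<in> X" for f h
  proof (rule finite_subset)
    show "finite {n. g n < h n}" using g[OF that] not_le_star_iff[of h g] by simp
  qed auto
  moreover have "infinite (range ?g)"
    unfolding infinite_nat_iff_unbounded
  proof
    fix m show "\<exists>n>m. n \<in> range ?g" by (rule exI[of _ "?g m"]) simp
  qed
  ultimately show ?thesis by (intro quasi_excluded_middleI[of ?g]) auto
qed

text \<open>The finite sets are dropped only to meet the definition of a splitting family: a finite
  set splits nothing.\<close>

lemma not_quasi_excluded_middle_imp_splitting_family:
  assumes "\<not> quasi_excluded_middle (<) (\<le>) X"
  shows "splitting_family {S \<in> (\<lambda>f. {n. f n < n}) ` X. infinite S}"
proof (rule ccontr)
  assume "\<not> ?thesis"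
  then obtain A where A: "infinite A"
    and unsplit: "\<And>f. f \<in> X \<Longrightarrow> infinite {n. f n < n} \<Longrightarrow>
      finite (A \<inter> {n. f n < n}) \<or> finite (A - {n. f n < n})"
    unfolding splitting_family_def by blast
  define g where "g n = (if n \<in> A then n else 0)" for n
  have side: "finite {n \<in> A. f n < n} \<or> finite {n \<in> A. n \<le> f n}" if "f \<in> X" for f
  proof -
    have "A \<inter> {n. f n < n} = {n \<in> A. f n < n}" "A - {n. f n < n} = {n \<in> A. n \<le> f n}" by auto
    \<comment> \<open>If \<open>{n. f n < n}\<close> is itself finite, \<open>unsplit\<close> does
      not apply, but its intersection with \<open>A\<close> is finite anyway.\<close>
    then show ?thesis using unsplit[OF that] by (metis finite_Int)
  qed
  have "finite {n. f n < g n \<and> g n \<le> h n} \<or> finite {n. h n < g n \<and> g n \<le> f n}"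
    if "f \<in> X" for f h
  proof -
    \<comment> \<open>Both conditions force \<open>0 < g n\<close>, hence \<open>n \<in> A\<close>
      and \<open>g n = n\<close>. The behaviour of \<open>f\<close> alone decides which set is
      finite.\<close>
    have "{n. f n < g n \<and> g n \<le> h n} \<subseteq> {n \<in> A. f n < n}"
      "{n. h n < g n \<and> g n \<le> f n} \<subseteq> {n \<in> A. n \<le> f n}"
      by (auto simp: g_def split: if_splits)
    then show ?thesis using side[OF that] finite_subset by blast
  qed
  moreover have "infinite (range g)"
  proof
    assume "finite (range g)"
    moreover have "A \<subseteq> range g" by (auto simp: g_def image_iff)
    ultimately show False using A finite_subset by blast
  qed
  ultimately have "quasi_excluded_middle (<) (\<le>) X"
    by (intro quasi_excluded_middleI[of g]) auto
  with assms show False by contradiction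
qed

lemma bounding_number_le_if_not_quasi:
  assumes "\<not> quasi_excluded_middle (\<le>) (\<le>) X"
  shows "bounding_number \<le>o |X|"
  using assms le_star_bounded_imp_quasi_excluded_middle bounding_number_le by blast

lemma splitting_number_le_if_not_quasi:
  assumes "\<not> quasi_excluded_middle (<) (\<le>) X"
  shows "splitting_number \<le>o |X|"
proof -
  let ?F = "(\<lambda>f. {n. f n < n}) ` X"
  have "splitting_number \<le>o |{S \<in> ?F. infinite S}|"
    using assms not_quasi_excluded_middle_imp_splitting_family splitting_number_le by blast
  also have "|{S \<in> ?F. infinite S}| \<le>o |?F|" by (rule card_of_mono1) auto
  also have "|?F| \<le>o |X|" by (rule card_of_image)
  finally show ?thesis .
qed

subsection \<open>Upper bounds\<close>

lemma ex_not_semi_excluded_middle: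
  obtains X where "\<not> semi_excluded_middle (\<le>) (<) X" "|X| \<le>o bounding_number"
proof -
  obtain B where B: "\<not> le_star_bounded B" "bounding_number = |B|"
    by (rule bounding_number_attained)
  \<comment> \<open>Each \<open>b\<close> is copied once onto the even and once onto the odd
    numbers, with value 0 elsewhere.\<close>
  let ?F = "\<lambda>b n. if even n then b (n div 2) else 0 :: nat"
  let ?H = "\<lambda>b n. if even n then 0 else b (n div 2) :: nat"
  let ?X = "?F ` B \<union> ?H ` B"
  have "\<exists>f\<in>?X. \<exists>h\<in>?X. infinite {n. f n \<le> g n \<and> g n < h n} \<and>
                       infinite {n. h n \<le> g n \<and> g n < f n}" for g
  proof -
    \<comment> \<open>The maximum lets a single \<open>b\<close> exceed \<open>g\<close> at both
      copies of the same infinitely many \<open>n\<close>.\<close>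
    obtain b where b: "b \<in> B" "\<not> b \<le>* (\<lambda>n. max (g (2 * n)) (g (2 * n + 1)))"
      using B(1) unfolding le_star_bounded_def by blast
    define N where "N = {n. max (g (2 * n)) (g (2 * n + 1)) < b n}"
    have "infinite N" using b(2) unfolding not_le_star_iff N_def .
    then have inf: "infinite ((\<lambda>n. 2 * n) ` N)" "infinite ((\<lambda>n. 2 * n + 1) ` N)"
      by (auto dest!: finite_imageD simp: inj_on_def)
    \<comment> \<open>At odd points \<open>?F b\<close> is 0, and \<open>0 \<le> g n\<close> holds
      for free because the first relation is not strict.\<close>
    have "infinite {n. ?F b n \<le> g n \<and> g n < ?H b n}"
      by (rule infinite_super[OF _ inf(2)]) (auto simp: N_def)
    moreover have "infinite {n. ?H b n \<le> g n \<and> g n < ?F b n}"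
      by (rule infinite_super[OF _ inf(1)]) (auto simp: N_def)
    ultimately show ?thesis
      using b(1) by (intro bexI[of _ "?F b"] bexI[of _ "?H b"] conjI UnI1 UnI2 imageI)
  qed
  then have "\<not> semi_excluded_middle (\<le>) (<) ?X"
    by (rule not_semi_excluded_middleI)
  moreover have "|?X| \<le>o bounding_number"
    unfolding B(2)
  proof (rule card_of_two_images_le)
    show "infinite (Field |B| )" using B(1) finite_imp_le_star_bounded by (auto simp: Field_card_of)
  qed (simp_all add: card_of_Card_order card_of_mono1)
  ultimately show thesis by (rule that)
qed

lemma infinite_ge_image:
  fixes e :: "nat \<Rightarrow> nat"
  assumes "infinite N" "\<And>n. n \<le> e n"
  shows "infinite (e ` N)"
  unfolding infinite_nat_iff_unbounded
proof
  fix m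
  obtain n where "m < n" "n \<in> N" using assms(1) unfolding infinite_nat_iff_unbounded by blast
  then show "\<exists>k>m. k \<in> e ` N" using less_le_trans[OF \<open>m < n\<close> assms(2)] by blast
qed

lemma infinite_nat_next:
  assumes "infinite (D :: nat set)"
  obtains e where "\<And>n. n \<le> e n" "\<And>n. e n \<in> D"
proof -
  have "\<forall>n. \<exists>m. n \<le> m \<and> m \<in> D" using assms unfolding infinite_nat_iff_unbounded_le by blast
  then show thesis using that by metis
qed

text \<open>A running maximum carries a large value \<open>b n\<close> forward to the points
  \<open>d n\<close> of \<open>D\<close> and \<open>e n\<close> of \<open>E\<close>, both at or
  beyond \<open>n\<close>. Comparing \<open>b\<close> with the maximum of \<open>g\<close> at these
  two points lets one \<open>b\<close> serve both sets.\<close>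

lemma unbounded_family_exceeds_on_two_sets:
  assumes "\<not> le_star_bounded B" "infinite D" "infinite E"
  obtains b where "b \<in> B"
    "infinite {n \<in> D. g n < Max (b ` {..n})}" "infinite {n \<in> E. g n < Max (b ` {..n})}"
proof -
  obtain d where d: "\<And>n. n \<le> d n" "\<And>n. d n \<in> D" using infinite_nat_next[OF assms(2)] by blast
  obtain e where e: "\<And>n. n \<le> e n" "\<And>n. e n \<in> E" using infinite_nat_next[OF assms(3)] by blast
  obtain b where b: "b \<in> B" "\<not> b \<le>* (\<lambda>n. max (g (d n)) (g (e n)))"
    using assms(1) unfolding le_star_bounded_def by blast
  define N where "N = {n. max (g (d n)) (g (e n)) < b n}"
  have N: "infinite N" using b(2) unfolding not_le_star_iff N_def .
  have le: "b n \<le> Max (b ` {..m})" if "n \<le> m" for n m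
    using that by (intro Max_ge) auto
  have "infinite {n \<in> D. g n < Max (b ` {..n})}"
  proof (rule infinite_super[OF _ infinite_ge_image[OF N d(1)]])
    show "d ` N \<subseteq> {n \<in> D. g n < Max (b ` {..n})}"
      using d(2) less_le_trans[OF _ le[OF d(1)]] by (auto simp: N_def simp del: Max_gr_iff)
  qed
  moreover have "infinite {n \<in> E. g n < Max (b ` {..n})}"
  proof (rule infinite_super[OF _ infinite_ge_image[OF N e(1)]])
    show "e ` N \<subseteq> {n \<in> E. g n < Max (b ` {..n})}"
      using e(2) less_le_trans[OF _ le[OF e(1)]] by (auto simp: N_def simp del: Max_gr_iff)
  qed
  ultimately show thesis using that b(1) by blast
qed

text \<open>Outside the support \<open>g\<close> takes only the value 0. The support is the set that
  a splitting family is asked to split.\<close>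

lemma infinite_support_if_infinite_range:
  fixes g :: "nat \<Rightarrow> nat"
  assumes "infinite (range g)"
  shows "infinite {n. 0 < g n}"
proof
  assume "finite {n. 0 < g n}"
  moreover have "range g \<subseteq> insert 0 (g ` {n. 0 < g n})" by auto
  ultimately show False using assms finite_subset by blast
qed

lemma ex_not_quasi_excluded_middle:
  obtains X where "\<not> quasi_excluded_middle (<) (<) X"
    "|X| \<le>o cmax splitting_number bounding_number"
proof -
  obtain B where B: "\<not> le_star_bounded B" "bounding_number = |B|"
    by (rule bounding_number_attained)
  obtain \<S> where S: "splitting_family \<S>" "splitting_number = |\<S>|"
    by (rule splitting_number_attained)
  let ?m = "cmax splitting_number bounding_number"
  let ?F = "\<lambda>(b, S) n. if n \<in> S then Max (b ` {..n}) else 0 :: nat"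
  let ?H = "\<lambda>(b, S) n. if n \<in> S then 0 else Max (b ` {..n}) :: nat"
  let ?X = "?F ` (B \<times> \<S>) \<union> ?H ` (B \<times> \<S>)"
  have "\<exists>f\<in>?X. \<exists>h\<in>?X. infinite {n. f n < g n \<and> g n < h n} \<and>
                       infinite {n. h n < g n \<and> g n < f n}"
    if g: "infinite (range g)" for g
  proof -
    \<comment> \<open>With a strict first relation, the value 0 of a switched-off function lies
      below \<open>g n\<close> only on \<open>D\<close>.\<close>
    define D where "D = {n. 0 < g n}"
    have "infinite D" unfolding D_def by (rule infinite_support_if_infinite_range[OF g])
    then obtain S where S': "S \<in> \<S>" "infinite (D \<inter> S)" "infinite (D - S)"
      using S(1) unfolding splitting_family_def by blast
    obtain b where b: "b \<in> B" "infinite {n \<in> D \<inter> S. g n < Max (b ` {..n})}"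
      "infinite {n \<in> D - S. g n < Max (b ` {..n})}"
      using unbounded_family_exceeds_on_two_sets[OF B(1) S'(2,3)] by blast
    have "infinite {n. ?F (b, S) n < g n \<and> g n < ?H (b, S) n}"
      by (rule infinite_super[OF _ b(3)]) (auto simp: D_def)
    moreover have "infinite {n. ?H (b, S) n < g n \<and> g n < ?F (b, S) n}"
      by (rule infinite_super[OF _ b(2)]) (auto simp: D_def)
    ultimately show ?thesis using b(1) S'(1)
      by (intro bexI[of _ "?F (b, S)"] bexI[of _ "?H (b, S)"] conjI)
        (blast intro: imageI)+
  qed
  then have "\<not> quasi_excluded_middle (<) (<) ?X"
    by (rule not_quasi_excluded_middleI)
  moreover have "|?X| \<le>o ?m"
  proof (rule card_of_two_images_le)
    show m: "Card_order ?m" by (simp add: cmax_def card_of_Card_order)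
    have "|\<S>| \<le>o ?m" "|B| \<le>o ?m"
      using le_cmax[of splitting_number bounding_number] B(2) S(2) card_of_Card_order by metis+
    \<comment> \<open>This makes the maximum an infinite cardinal, so the product of two sets no
      larger than it is again no larger.\<close>
    moreover have "infinite B" using B(1) finite_imp_le_star_bounded by blast
    ultimately show inf: "infinite (Field ?m)"
      using m by (meson card_of_Field_ordIso card_of_ordLeq_infinite ordIso_symmetric
          ordLeq_ordIso_trans)
    show "|B \<times> \<S>| \<le>o ?m"
      using card_of_Times_ordLeq_infinite_Field[OF inf] \<open>|\<S>| \<le>o ?m\<close> \<open>|B| \<le>o ?m\<close> m by blast
  qed
  ultimately show thesis by (rule that)
qed

theorem theoremA3:
  shows "((\<forall>X. semi_excluded_middle (<) (\<le>) X) \<and>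
          x_semi (<) (\<le>) = None \<and> x_semi (<) (<) = None) \<and>
         (x_quasi (\<le>) (\<le>) =e Some bounding_number \<and>
          x_quasi (\<le>) (<) =e Some bounding_number \<and>
          x_semi (\<le>) (\<le>) =e Some bounding_number \<and>
          x_semi (\<le>) (<) =e Some bounding_number) \<and>
         (x_quasi (<) (\<le>) =e Some (cmax splitting_number bounding_number) \<and>
          x_quasi (<) (<) =e Some (cmax splitting_number bounding_number))"
proof (intro conjI allI)
  have semi_lt: "semi_excluded_middle (<) (<) X" for X
    by (rule semi_excluded_middle_mono[OF semi_excluded_middle_less_le]) simp_all
  show "semi_excluded_middle (<) (\<le>) X" for X by (rule semi_excluded_middle_less_le)
  show "x_semi (<) (\<le>) = None" "x_semi (<) (<) = None"
    by (simp_all add: x_semi_def least_ecard_def semi_excluded_middle_less_le semi_lt)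

  \<comment> \<open>\<open>X\<close> fails the weakest of the four properties, hence all of them. A
    set failing any of them fails the strongest,
    \<open>quasi_excluded_middle (\<le>) (\<le>)\<close>, which gives the lower bound.\<close>
  obtain X where X: "\<not> semi_excluded_middle (\<le>) (<) X" "|X| \<le>o bounding_number"
    by (rule ex_not_semi_excluded_middle)
  have q: "quasi_excluded_middle (\<le>) (<) Z" if "quasi_excluded_middle (\<le>) (\<le>) Z" for Z
    using that by (rule quasi_excluded_middle_mono) simp_all
  have s: "semi_excluded_middle (\<le>) (<) Z" if "semi_excluded_middle (\<le>) (\<le>) Z" for Z
    using that by (rule semi_excluded_middle_mono) simp_all
  note imps = q s quasi_imp_semi_excluded_middle
  show "x_quasi (\<le>) (\<le>) =e Some bounding_number" unfolding x_quasi_def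
    by (rule least_ecard_eqI[OF _ X(2)]) (use X(1) bounding_number_le_if_not_quasi imps in blast)+
  show "x_quasi (\<le>) (<) =e Some bounding_number" unfolding x_quasi_def
    by (rule least_ecard_eqI[OF _ X(2)]) (use X(1) bounding_number_le_if_not_quasi imps in blast)+
  show "x_semi (\<le>) (\<le>) =e Some bounding_number" unfolding x_semi_def
    by (rule least_ecard_eqI[OF _ X(2)]) (use X(1) bounding_number_le_if_not_quasi imps in blast)+
  show "x_semi (\<le>) (<) =e Some bounding_number" unfolding x_semi_def
    by (rule least_ecard_eqI[OF _ X(2)]) (use X(1) bounding_number_le_if_not_quasi imps in blast)+

  let ?m = "cmax splitting_number bounding_number"
  \<comment> \<open>Again one witness against the weaker property serves for both, and the lower
    bound is needed only for the stronger one,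
    \<open>quasi_excluded_middle (<) (\<le>)\<close>.\<close>
  obtain Y where Y: "\<not> quasi_excluded_middle (<) (<) Y" "|Y| \<le>o ?m"
    by (rule ex_not_quasi_excluded_middle)
  have lt: "quasi_excluded_middle (<) (<) Z" if "quasi_excluded_middle (<) (\<le>) Z" for Z
    using that by (rule quasi_excluded_middle_mono) simp_all
  have le: "quasi_excluded_middle (<) (\<le>) Z" if "quasi_excluded_middle (\<le>) (\<le>) Z" for Z
    using that by (rule quasi_excluded_middle_mono) simp_all
  have lower: "?m \<le>o |Z|" if "\<not> quasi_excluded_middle (<) (\<le>) Z" for Z
  proof (rule cmax_le)
    show "Card_order splitting_number" "Card_order bounding_number"
      unfolding splitting_number_def bounding_number_def by (rule Card_order_least_card)+
    show "splitting_number \<le>o |Z|" using that by (rule splitting_number_le_if_not_quasi)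
    show "bounding_number \<le>o |Z|" using that le bounding_number_le_if_not_quasi by blast
  qed
  show "x_quasi (<) (\<le>) =e Some ?m" unfolding x_quasi_def
    by (rule least_ecard_eqI[OF _ Y(2)]) (use Y(1) lt lower in blast)+
  show "x_quasi (<) (<) =e Some ?m" unfolding x_quasi_def
    by (rule least_ecard_eqI[OF _ Y(2)]) (use Y(1) lt lower in blast)+
qed

end
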